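(* Let $L$ be a non-reduced multiplicative lattice. Then $Z(L)$ is not an ideal of $L$ if and only if $diam(\Gamma^m(L))=3$.
   Context: A multiplicative lattice is a complete lattice $L$ (least element $0$, greatest element $1$) with a binary operation $\cdot$ that is commutative and associative and satisfies, for all $a,b,b_\alpha\in L$: $a\cdot(\bigvee_\alpha b_\alpha)=\bigvee_\alpha (a\cdot b_\alpha)$, $a\cdot b\le a\wedge b$, and $a\cdot 1=a$. It is reduced if $a^n=0$ for some positive integer $n$ implies $a=0$, and non-reduced otherwise. An ideal of $L$ is a non-empty subset closed downwards and under binary joins. $(Z(L))^*=\{x\in L: x\neq 0,\ x\cdot y=0\text{ for some }y\ne 0\text{ in }L\}$ and $Z(L)=(Z(L))^*\cup\{0\}$. The graph $\Gamma^m(L)$ is the simple undirected graph with vertex set $(Z(L))^*$, two distinct vertices $a,b$ being adjacent iff $a\cdot b=0$. The diameter $diam(G)$ of a graph is $0$ if $G$ has one vertex and otherwise the supremum of the distances $d(x,y)$ (length of a shortest path, $\infty$ if none) over distinct vertices $x,y$. *)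

theory Defs
  imports Main "HOL-Library.Extended_Nat" "Graph_Theory.Pair_Digraph"
begin

text \<open>The least element 0 of the lattice is \<^term>\<open>bot\<close> and the greatest element 1 is \<^term>\<open>top\<close>.
  The constant \<^term>\<open>1\<close> of the monoid is identified with \<^term>\<open>top\<close>, so that the monoid axiom
  \<open>1 * a = a\<close> is the axiom \<open>a \<cdot> 1 = a\<close> and powers \<open>a ^ n\<close> are available.\<close>

class multiplicative_lattice = complete_lattice + comm_monoid_mult +
  assumes one_eq_top: "1 = top"
    and mult_Sup: "a * Sup B = Sup ((\<lambda>b. a * b) ` B)"
    and mult_le_inf: "a * b \<le> inf a b"

definition reduced :: "'a::multiplicative_lattice itself \<Rightarrow> bool" where
  "reduced _ \<longleftrightarrow> (\<forall>a::'a. (\<exists>n::nat. n > 0 \<and> a ^ n = bot) \<longrightarrow> a = bot)"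

definition lattice_ideal :: "'a::lattice set \<Rightarrow> bool" where
  "lattice_ideal I \<longleftrightarrow>
     I \<noteq> {} \<and> (\<forall>x\<in>I. \<forall>y. y \<le> x \<longrightarrow> y \<in> I) \<and> (\<forall>x\<in>I. \<forall>y\<in>I. sup x y \<in> I)"

definition nonzero_zero_divisors :: "'a::multiplicative_lattice set" where
  "nonzero_zero_divisors = {x. x \<noteq> bot \<and> (\<exists>y. y \<noteq> bot \<and> x * y = bot)}"

definition zero_divisors :: "'a::multiplicative_lattice set" where
  "zero_divisors = nonzero_zero_divisors \<union> {bot}"

text \<open>A simple undirected graph is represented by a symmetric loop-free digraph
  without parallel arcs.\<close>

definition zero_divisor_graph :: "'a::multiplicative_lattice pair_pre_digraph" where
  "zero_divisor_graph =
     \<lparr> pverts = nonzero_zero_divisors,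
       parcs = {(a, b). a \<in> nonzero_zero_divisors \<and> b \<in> nonzero_zero_divisors \<and>
                        a \<noteq> b \<and> a * b = bot} \<rparr>"

lemma zero_divisor_graph_simple:
  "pair_sym_digraph zero_divisor_graph" "pair_loopfree_digraph zero_divisor_graph"
  by unfold_locales
    (auto simp: zero_divisor_graph_def symmetric_def sym_def mult.commute)

text \<open>Paths are lists of arcs, so \<^term>\<open>length p\<close> is the number of edges. The infimum of the
  empty set in \<^typ>\<open>enat\<close> is \<open>\<infinity>\<close>.\<close>

definition graph_dist :: "'a pair_pre_digraph \<Rightarrow> 'a \<Rightarrow> 'a \<Rightarrow> enat" where
  "graph_dist G u v = (INF p \<in> {p. pre_digraph.apath (with_proj G) u p v}. enat (length p))"

definition graph_diam :: "'a pair_pre_digraph \<Rightarrow> enat" where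
  "graph_diam G =
     (if \<exists>v. pverts G = {v} then 0
      else Sup {graph_dist G u v | u v. u \<in> pverts G \<and> v \<in> pverts G \<and> u \<noteq> v})"

end

theory Submission
  imports Defs
begin

text \<open>
  The theorem reduces to common annihilators. Two distinct vertices \<open>u\<close>, \<open>v\<close> of the graph are
  at distance at least 3 exactly when \<open>u * v\<close> is nonzero and no nonzero element kills both, and
  since multiplication distributes over joins the latter says that nothing nonzero kills
  \<open>sup u v\<close>. The distance never exceeds 3, because nonzero annihilators \<open>x\<close> of \<open>u\<close> and \<open>y\<close> of \<open>v\<close>
  either have a nonzero product, which kills both, or are equal or adjacent
  (\<open>graph_dist_le_three\<close>). So the diameter is 3 iff some \<open>u\<close>, \<open>v\<close> are at distance at least 3.

  If the zero divisors form an ideal, then \<open>sup u v\<close> always has a nonzero annihilator, so this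
  cannot happen. Conversely, the set of zero divisors is always closed downwards, so if it is not
  an ideal there are zero divisors \<open>a\<close>, \<open>b\<close> whose join is regular,
  that is, killed by nothing nonzero. Only \<open>a * b = bot\<close> can spoil
  the distance 3, and here non-reducedness enters: there is a nonzero \<open>x\<close> with \<open>x * x = bot\<close>,
  regularity of \<open>sup a b\<close> makes (say) \<open>a * x\<close> nonzero, and replacing \<open>b\<close> by \<open>sup b (a * x)\<close>
  repairs the pair (\<open>regular_join_nonzero_product\<close>).
\<close>

section \<open>Arithmetic of a multiplicative lattice\<close>

lemma mult_bot [simp]: "(a::'a::multiplicative_lattice) * bot = bot"
  using mult_Sup[of a "{}"] by simp

lemma bot_mult [simp]: "bot * (a::'a::multiplicative_lattice) = bot"
  using mult_bot[of a] by (subst mult.commute)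

lemma mult_sup_distrib: "(a::'a::multiplicative_lattice) * sup b c = sup (a * b) (a * c)"
  using mult_Sup[of a "{b, c}"] by simp

lemma sup_mult_eq_bot_iff:
  "sup a b * (c::'a::multiplicative_lattice) = bot \<longleftrightarrow> a * c = bot \<and> b * c = bot"
  using mult_sup_distrib[of c a b] by (simp add: mult.commute sup_eq_bot_iff)

lemma mult_eq_bot_mono:
  assumes "(x::'a::multiplicative_lattice) \<le> y" and "y * c = bot"
  shows "x * c = bot"
  using assms sup_mult_eq_bot_iff[of x y c] by (simp add: sup_absorb2)

lemma mem_zero_divisors_iff:
  "(x::'a::multiplicative_lattice) \<in> zero_divisors \<longleftrightarrow>
     x = bot \<or> (\<exists>y. y \<noteq> bot \<and> x * y = bot)"
  by (auto simp: zero_divisors_def nonzero_zero_divisors_def)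

lemma lattice_ideal_zero_divisors_iff:
  "lattice_ideal (zero_divisors :: 'a::multiplicative_lattice set) \<longleftrightarrow>
     (\<forall>a\<in>nonzero_zero_divisors. \<forall>b\<in>nonzero_zero_divisors. sup a b \<in> (zero_divisors :: 'a set))"
proof -
  have "y \<in> zero_divisors" if "x \<in> zero_divisors" "y \<le> x" for x y :: 'a
    using that mult_eq_bot_mono bot_unique unfolding mem_zero_divisors_iff by metis
  then show ?thesis
    unfolding lattice_ideal_def zero_divisors_def by auto
qed

text \<open>If \<open>n\<close> is the least exponent with \<open>a ^ n = bot\<close>, then \<open>a ^ (n - 1)\<close> has square zero,
  as \<open>n \<le> 2 * (n - 1)\<close> for \<open>n \<ge> 2\<close>.\<close>

lemma ex_square_zero_if_not_reduced:
  assumes "\<not> reduced TYPE('a::multiplicative_lattice)"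
  obtains x :: "'a::multiplicative_lattice" where "x \<noteq> bot" "x * x = bot"
proof -
  from assms obtain a :: 'a and m where a: "a \<noteq> bot" "a ^ m = bot"
    unfolding reduced_def by blast
  define n where "n = (LEAST k. a ^ k = bot)"
  have n: "a ^ n = bot"
    unfolding n_def using a(2) by (rule LeastI)
  have least: "a ^ k \<noteq> bot" if "k < n" for k
    using that not_less_Least unfolding n_def by blast
  have "n \<noteq> 0"
  proof
    assume "n = 0"
    then have "1 = (bot::'a)" using n by simp
    then have "a = bot" using mult_1_left[of a] bot_mult[of a] by metis
    with a(1) show False by blast
  qed
  moreover have "n \<noteq> 1" using n a(1) by auto
  ultimately obtain k where k: "n = Suc (Suc k)"
    by (metis One_nat_def not0_implies_Suc)
  have "Suc k + Suc k = n + k" using k by simp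
  then have "a ^ Suc k * a ^ Suc k = a ^ n * a ^ k"
    by (simp only: power_add[symmetric])
  then have "a ^ Suc k * a ^ Suc k = bot" using n by simp
  moreover have "a ^ Suc k \<noteq> bot" using k by (intro least) simp
  ultimately show thesis using that by blast
qed

text \<open>When \<open>a * b = bot\<close> and \<open>a * x\<close> is nonzero, put \<open>b' = sup b (a * x)\<close>. It is killed by
  \<open>a * x\<close>, since \<open>a * b\<close> and \<open>x * x\<close> vanish, and \<open>sup a b'\<close> stays regular. Moreover
  \<open>a * b' = a * a * x\<close> is nonzero: otherwise \<open>a * x\<close> would kill both \<open>a\<close> and \<open>b\<close>.
  If instead \<open>b * x\<close> is nonzero, exchange \<open>a\<close> and \<open>b\<close>.\<close>

lemma regular_join_nonzero_product:
  fixes x a b :: "'a::multiplicative_lattice"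
  assumes x: "x \<noteq> bot" "x * x = bot"
    and a: "a \<in> nonzero_zero_divisors" and b: "b \<in> nonzero_zero_divisors"
    and regular: "sup a b \<notin> zero_divisors"
  obtains u v :: 'a where "u \<in> nonzero_zero_divisors" "v \<in> nonzero_zero_divisors"
    "sup u v \<notin> zero_divisors" "u * v \<noteq> bot"
proof -
  note result = that
  have repair: thesis
    if a: "a \<in> nonzero_zero_divisors" and b: "b \<in> nonzero_zero_divisors"
      and regular: "sup a b \<notin> zero_divisors" and ab: "a * b = bot" and ax: "a * x \<noteq> bot"
    for a b :: 'a
  proof -
    let ?b = "sup b (a * x)"
    have "b * (a * x) = (a * b) * x" "(a * x) * (a * x) = (a * a) * (x * x)"
      by (simp_all add: ac_simps)
    then have kill: "b * (a * x) = bot" "(a * x) * (a * x) = bot"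
      using ab x(2) by simp_all
    then have "?b * (a * x) = bot" by (simp add: sup_mult_eq_bot_iff)
    then have b': "?b \<in> nonzero_zero_divisors"
      using b ax by (auto simp: nonzero_zero_divisors_def sup_eq_bot_iff)
    have regular': "sup a ?b \<notin> zero_divisors"
      using regular
      by (auto simp: mem_zero_divisors_iff sup_mult_eq_bot_iff sup_eq_bot_iff)
    have "a * ?b \<noteq> bot"
    proof
      assume "a * ?b = bot"
      then have "a * (a * x) = bot" by (simp add: mult_sup_distrib sup_eq_bot_iff)
      with kill(1) have "sup a b * (a * x) = bot" by (simp add: sup_mult_eq_bot_iff)
      with ax regular show False by (auto simp: mem_zero_divisors_iff)
    qed
    then show thesis by (rule result[OF a b' regular'])
  qed
  have "sup a b * x \<noteq> bot" using regular x(1) by (auto simp: mem_zero_divisors_iff)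
  then consider "a * b \<noteq> bot" | "a * b = bot" "a * x \<noteq> bot" | "a * b = bot" "b * x \<noteq> bot"
    by (auto simp: sup_mult_eq_bot_iff)
  then show thesis
  proof cases
    case 1
    then show thesis by (rule result[OF a b regular])
  next
    case 2
    then show thesis by (rule repair[OF a b regular])
  next
    case 3
    have "sup b a \<notin> zero_divisors" "b * a = bot"
      using regular 3(1) by (simp_all add: sup.commute[of b a] mult.commute[of b a])
    then show thesis using 3(2) by (rule repair[OF b a])
  qed
qed

section \<open>Distances in the zero-divisor graph\<close>

lemma graph_dist_le_length:
  assumes "pre_digraph.apath (with_proj G) u p v"
  shows "graph_dist G u v \<le> enat (length p)"
  unfolding graph_dist_def using assms by (auto intro: INF_lower)

lemma apath_zero_divisor_graph_iff:
  "pre_digraph.apath (with_proj zero_divisor_graph) (u::'a::multiplicative_lattice) p v \<longleftrightarrow>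
     u \<in> nonzero_zero_divisors \<and>
     (\<forall>(a, b)\<in>set p. a \<in> nonzero_zero_divisors \<and> b \<in> nonzero_zero_divisors \<and>
        a \<noteq> b \<and> a * b = bot) \<and>
     pre_digraph.cas (with_proj zero_divisor_graph) u p v \<and>
     distinct (pre_digraph.awalk_verts (with_proj zero_divisor_graph) u p)"
  unfolding pre_digraph.apath_def pre_digraph.awalk_def
  by (auto simp: zero_divisor_graph_def)

lemmas apath_simps =
  apath_zero_divisor_graph_iff pre_digraph.cas.simps pre_digraph.awalk_verts.simps

lemma graph_dist_le_one:
  assumes "(u::'a::multiplicative_lattice) \<in> nonzero_zero_divisors" "v \<in> nonzero_zero_divisors"
    and "u \<noteq> v" "u * v = bot"
  shows "graph_dist zero_divisor_graph u v \<le> 1"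
  using graph_dist_le_length[of zero_divisor_graph u "[(u, v)]" v] assms
  by (simp add: apath_simps one_enat_def)

text \<open>The middle vertex of the path \<open>u\<close>, \<open>c\<close>, \<open>v\<close> collapses onto an end only if
  \<open>u\<close> and \<open>v\<close> are already adjacent.\<close>

lemma graph_dist_le_two:
  assumes uv: "(u::'a::multiplicative_lattice) \<in> nonzero_zero_divisors"
      "v \<in> nonzero_zero_divisors" "u \<noteq> v"
    and c: "c \<noteq> bot" "u * c = bot" "v * c = bot"
  shows "graph_dist zero_divisor_graph u v \<le> 2"
proof (cases "u * v = bot")
  case True
  then have "graph_dist zero_divisor_graph u v \<le> 1" by (rule graph_dist_le_one[OF uv])
  then show ?thesis by (rule order_trans) simp
next
  case False
  then have "c \<noteq> u" "c \<noteq> v" using c by (auto simp: mult.commute)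
  moreover have "c \<in> nonzero_zero_divisors"
    using c uv mult.commute[of u c] by (auto simp: nonzero_zero_divisors_def)
  ultimately show ?thesis
    using graph_dist_le_length[of zero_divisor_graph u "[(u, c), (c, v)]" v] uv c
      mult.commute[of v c]
    by (simp add: apath_simps numeral_eq_enat numeral_eq_Suc)
qed

text \<open>Choose nonzero \<open>x\<close>, \<open>y\<close> killing \<open>u\<close>, \<open>v\<close>. Whenever the walk \<open>u\<close>, \<open>x\<close>, \<open>y\<close>, \<open>v\<close> fails to
  be a path, one of \<open>x\<close>, \<open>y\<close>, \<open>x * y\<close> is a nonzero common annihilator of \<open>u\<close> and \<open>v\<close>, or
  \<open>u\<close> and \<open>v\<close> are adjacent.\<close>

lemma graph_dist_le_three:
  assumes uv: "(u::'a::multiplicative_lattice) \<in> nonzero_zero_divisors"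
      "v \<in> nonzero_zero_divisors" "u \<noteq> v"
  shows "graph_dist zero_divisor_graph u v \<le> 3"
proof (cases "graph_dist zero_divisor_graph u v \<le> 2")
  case True
  then show ?thesis by (rule order_trans) simp
next
  case False
  with graph_dist_le_two[OF uv] have no_common: "c = bot" if "u * c = bot" "v * c = bot" for c
    using that by blast
  have "u * v \<noteq> bot"
    using False graph_dist_le_one[OF uv] order_trans[of _ 1 "2::enat"] by auto
  obtain x y where x: "x \<noteq> bot" "u * x = bot" and y: "y \<noteq> bot" "v * y = bot"
    using uv by (auto simp: nonzero_zero_divisors_def)
  have "u * (x * y) = (u * x) * y" "v * (x * y) = (v * y) * x" by (simp_all add: ac_simps)
  with x y no_common have xy: "x * y = bot" by simp
  have "x \<noteq> v" "y \<noteq> u" using x y \<open>u * v \<noteq> bot\<close> by (auto simp: mult.commute)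
  moreover have "x \<noteq> u" "y \<noteq> v" "x \<noteq> y"
    using no_common[of x] no_common[of y] x y xy by (auto simp: mult.commute)
  moreover have "x \<in> nonzero_zero_divisors" "y \<in> nonzero_zero_divisors"
    using x y xy mult.commute[of u x] mult.commute[of v y] uv
    by (auto simp: nonzero_zero_divisors_def)
  ultimately show ?thesis
    using graph_dist_le_length[of zero_divisor_graph u "[(u, x), (x, y), (y, v)]" v] uv x y xy
      mult.commute[of v y]
    by (simp add: apath_simps numeral_eq_enat numeral_eq_Suc)
qed

lemma three_le_graph_dist:
  assumes "(u::'a::multiplicative_lattice) \<noteq> v" "u * v \<noteq> bot"
    and no_common: "\<And>c. u * c = bot \<Longrightarrow> v * c = bot \<Longrightarrow> c = bot"
  shows "3 \<le> graph_dist zero_divisor_graph u v"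
  unfolding graph_dist_def
proof (rule INF_greatest)
  fix p
  assume "p \<in> {p. pre_digraph.apath (with_proj zero_divisor_graph) u p v}"
  then have p: "pre_digraph.apath (with_proj zero_divisor_graph) u p v" by simp
  have "3 \<le> length p"
  proof (rule ccontr)
    assume "\<not> 3 \<le> length p"
    then consider "p = []" | e where "p = [e]" | e f where "p = [e, f]"
      by (auto simp: not_le numeral_eq_Suc less_Suc_eq length_Suc_conv)
    then show False
    proof cases
      case 1
      with p \<open>u \<noteq> v\<close> show False by (simp add: apath_simps)
    next
      case (2 e)
      with p \<open>u * v \<noteq> bot\<close> show False by (cases e) (auto simp: apath_simps)
    next
      case (3 e f)
      then obtain c where "c \<in> nonzero_zero_divisors" "u * c = bot" "c * v = bot"
        using p by (cases e; cases f) (auto simp: apath_simps)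
      with no_common[of c] show False by (simp add: nonzero_zero_divisors_def mult.commute)
    qed
  qed
  then show "3 \<le> enat (length p)" by (simp add: numeral_eq_enat)
qed

section \<open>The diameter and the ideal property\<close>

lemma graph_diam_le:
  assumes "\<And>u v. u \<in> pverts G \<Longrightarrow> v \<in> pverts G \<Longrightarrow> u \<noteq> v \<Longrightarrow> graph_dist G u v \<le> d"
  shows "graph_diam G \<le> d"
  unfolding graph_diam_def using assms by (auto intro!: Sup_least)

lemma graph_dist_le_graph_diam:
  assumes "u \<in> pverts G" "v \<in> pverts G" "u \<noteq> v"
  shows "graph_dist G u v \<le> graph_diam G"
proof -
  have "\<not> (\<exists>w. pverts G = {w})" using assms by auto
  then show ?thesis unfolding graph_diam_def using assms by (auto intro!: Sup_upper)
qed

theorem theorem2p23: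
  assumes "\<not> reduced TYPE('a::multiplicative_lattice)"
  shows "\<not> lattice_ideal (zero_divisors :: 'a set) \<longleftrightarrow>
         graph_diam (zero_divisor_graph :: 'a pair_pre_digraph) = 3"
proof
  have verts: "pverts zero_divisor_graph = (nonzero_zero_divisors :: 'a set)"
    by (simp add: zero_divisor_graph_def)
  {
    assume "\<not> lattice_ideal (zero_divisors :: 'a set)"
    then obtain a b :: 'a where ab: "a \<in> nonzero_zero_divisors" "b \<in> nonzero_zero_divisors"
        "sup a b \<notin> zero_divisors"
      unfolding lattice_ideal_zero_divisors_iff by blast
    obtain x :: 'a where "x \<noteq> bot" "x * x = bot"
      using ex_square_zero_if_not_reduced[OF assms] .
    then obtain u v :: 'a where uv: "u \<in> nonzero_zero_divisors" "v \<in> nonzero_zero_divisors"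
        "sup u v \<notin> zero_divisors" "u * v \<noteq> bot"
      using regular_join_nonzero_product ab by metis
    have "u \<noteq> v" using uv by (auto simp: zero_divisors_def)
    have "c = bot" if "u * c = bot" "v * c = bot" for c
      using that uv(3) by (auto simp: mem_zero_divisors_iff sup_mult_eq_bot_iff)
    then have "3 \<le> graph_dist zero_divisor_graph u v"
      by (rule three_le_graph_dist[OF \<open>u \<noteq> v\<close> uv(4)])
    also have "\<dots> \<le> graph_diam (zero_divisor_graph :: 'a pair_pre_digraph)"
      using uv \<open>u \<noteq> v\<close> by (intro graph_dist_le_graph_diam) (simp_all add: verts)
    finally have "3 \<le> graph_diam (zero_divisor_graph :: 'a pair_pre_digraph)" .
    moreover have "graph_diam (zero_divisor_graph :: 'a pair_pre_digraph) \<le> 3"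
      by (rule graph_diam_le) (simp add: verts graph_dist_le_three)
    ultimately show "graph_diam (zero_divisor_graph :: 'a pair_pre_digraph) = 3" by simp
  }
  {
    assume diam: "graph_diam (zero_divisor_graph :: 'a pair_pre_digraph) = 3"
    show "\<not> lattice_ideal (zero_divisors :: 'a set)"
    proof
      assume ideal: "lattice_ideal (zero_divisors :: 'a set)"
      have "graph_diam (zero_divisor_graph :: 'a pair_pre_digraph) \<le> 2"
      proof (rule graph_diam_le, unfold verts)
        fix u v :: 'a
        assume uv: "u \<in> nonzero_zero_divisors" "v \<in> nonzero_zero_divisors" "u \<noteq> v"
        then have "sup u v \<in> zero_divisors" "sup u v \<noteq> bot"
          using ideal unfolding lattice_ideal_zero_divisors_iff
          by (auto simp: nonzero_zero_divisors_def sup_eq_bot_iff)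
        then obtain c where "c \<noteq> bot" "u * c = bot" "v * c = bot"
          by (auto simp: mem_zero_divisors_iff sup_mult_eq_bot_iff)
        then show "graph_dist zero_divisor_graph u v \<le> 2" by (rule graph_dist_le_two[OF uv])
      qed
      with diam show False by simp
    qed
  }
qed

end
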